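(* Let $(G=(V,E),W)$ be a weighted graph, $g=\{g_{i,t}\}_{i\in V,t>0}$ an updating rule, and $A=\{A_{i,t}\}_{i\in V,t\ge0}$ a dynamics on $G$ induced by $g$ with any set of stubborn agents and with $\beta$-distorted monitoring, where the initial opinions $\{A_{i,0}\}_{i\in V}$ are arbitrary numbers in $[0,1]$. Suppose that: 1. $G$ has a sub-exponential growth rate; 2. $\sup_{i\in V}W(i)<\infty$; 3. either $\beta\ge0$ and $g$ satisfies Condition (A3), or $\beta=0$ and $g$ satisfies Condition (A3'), with respect to some $\gamma>\beta$ and $\eta>0$. Then all the limits $Z_i=(\lim_{t\to\infty}A_{i,2t+\iota})_{\iota=0,1}$ exist, for every $i\in V$.
   Context: Weighted graph. $(G,W)$: $G=(V,E)$ is a connected graph, finite or countably infinite, and $W\colon V\times V\to\mathbb R_+$ is symmetric, with $W(i,j)>0$ only if $ij\in E$ or $i=j$, and $W(i,j)\ge1$ for all $ij\in E$. $W(i):=\sum_{j\in V}W(i,j)$. $N_i$ is the set of neighbors of $i$ in $G$ and $(i):=\{i\}\cup N_i$. $G$ has sub-exponential growth rate if for some (equivalently every) vertex $i$, $\lim_{r\to\infty}\frac1r\log|B(i,r)|=0$, where $B(i,r)$ is the ball of radius $r$ around $i$. Histories and updating rules. $\mathcal H$ is the set of all functions $A\colon V\times\mathbb Z_+\to[0,1]$; $A_{(i),<t}$ is the restriction of $A$ to $(i)\times\{0,\dots,t-1\}$, and $\mathcal H_{(i),<t}=\{A_{(i),<t}:A\in\mathcal H\}$. An updating rule is a collection of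 functions $g_{i,t}\colon\mathcal H_{(i),<t}\to[0,1]$, $i\in V$, $t>0$. Without distortion or stubborn agents, it induces the dynamics $A_{i,t}=g_{i,t}(A_{(i),<t})$. A stubborn agent instead keeps a constant opinion in $[0,1]$ at all times. With $\beta$-distorted monitoring ($\beta\ge 0$), each non-stubborn agent $i$ has at each time $t>0$ the opinion $A_{i,t}=g_{i,t}(A'_{(i),<t})$ for some (arbitrary) $A'_{(i),<t}\in\mathcal H_{(i),<t}$ (possibly depending on $i$ and $t$) with $|A'_{j,s}-A_{j,s}|\le\beta$ for $j\in N_i$ and $A'_{i,s}=A_{i,s}$, for all $0\le s<t$. DeGroot value: $g_D(A_{(i),<t}):=\frac1{W(i)}\sum_{j\in V}W(i,j)A_{j,t-1}$. Condition (A3) with respect to $\gamma,\eta>0$: for every $i\in V$, $t\ge2$ and $A_{(i),<t}\in\mathcal H_{(i),<t}$, writing $g_D=g_D(A_{(i),<t})$ and $g_{i,t}=g_{i,t}(A_{(i),<t})$, for all $v\in[g_D-\gamma,g_D+\gamma]$, $$\eta\,|g_{i,t}-A_{i,t-2}|\le(A_{i,t-2}-v)^2-(g_{i,t}-v)^2 .$$ Condition (A3') with respect to $\gamma,\eta>0$: the same inequality, for all $i\in V$, $t\ge2$ and $v\in[g_D-\gamma,g_D+\gamma]$, but required only for $A_{(i),<t}\in\mathcal H^g_{(i),<t}:=\{A_{(i),<t}:A\in\mathcal H^g\}$, where $\mathcal H^g$ is the set of histories consistent with $g$, i.e. the histories $A\in\mathcal H$ with $A_{i,t}=g_{i,t}(A_{(i),<t})$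 for all $i\in V$ and $t>0$.
   Formalization: With stubborn agents present, Condition (A3') is required for histories consistent with the dynamics in which the stubborn agents keep their initial opinion and the others follow g, not for histories consistent with g alone; under the latter reading the claim is false. *)

theory Defs
  imports "HOL-Analysis.Analysis"
begin

section \<open>Weighted graphs\<close>

text \<open>A simple graph is a vertex set \<open>V\<close> with a set \<open>E\<close> of two-element subsets of \<open>V\<close>.\<close>

definition adj :: "'v set set \<Rightarrow> ('v \<times> 'v) set" where
  "adj E = {(i, j). {i, j} \<in> E}"

definition nbrs :: "'v set set \<Rightarrow> 'v \<Rightarrow> 'v set" where
  "nbrs E i = {j. {i, j} \<in> E}"

definition closed_nbrs :: "'v set set \<Rightarrow> 'v \<Rightarrow> 'v set" where
  "closed_nbrs E i = insert i (nbrs E i)"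

definition connected_graph :: "'v set \<Rightarrow> 'v set set \<Rightarrow> bool" where
  "connected_graph V E \<longleftrightarrow>
     (\<forall>e\<in>E. \<exists>i\<in>V. \<exists>j\<in>V. i \<noteq> j \<and> e = {i, j}) \<and>
     (\<forall>i\<in>V. \<forall>j\<in>V. (i, j) \<in> (adj E)\<^sup>*)"

definition weighted_graph :: "'v set \<Rightarrow> 'v set set \<Rightarrow> ('v \<Rightarrow> 'v \<Rightarrow> real) \<Rightarrow> bool" where
  "weighted_graph V E W \<longleftrightarrow>
     countable V \<and> connected_graph V E \<and>
     (\<forall>i\<in>V. \<forall>j\<in>V. 0 \<le> W i j \<and> W i j = W j i) \<and>
     (\<forall>i\<in>V. \<forall>j\<in>V. W i j > 0 \<longrightarrow> {i, j} \<in> E \<or> i = j) \<and>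
     (\<forall>i\<in>V. \<forall>j\<in>V. {i, j} \<in> E \<longrightarrow> W i j \<ge> 1)"

text \<open>The total weight is taken in \<open>[0, \<infinity>]\<close>, because a divergent real-valued
  \<^const>\<open>infsum\<close> would be \<open>0\<close>.\<close>

definition total_weight :: "'v set \<Rightarrow> ('v \<Rightarrow> 'v \<Rightarrow> real) \<Rightarrow> 'v \<Rightarrow> ennreal" where
  "total_weight V W i = (\<Sum>\<^sub>\<infinity>j\<in>V. ennreal (W i j))"

definition graph_ball :: "'v set set \<Rightarrow> 'v \<Rightarrow> nat \<Rightarrow> 'v set" where
  "graph_ball E i r = {j. \<exists>n\<le>r. (i, j) \<in> adj E ^^ n}"

text \<open>Finiteness of the balls is required explicitly, since the cardinality of an infinite
  set is \<open>0\<close> and \<open>ln 0 = 0\<close>.\<close>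

definition subexponential_growth :: "'v set \<Rightarrow> 'v set set \<Rightarrow> bool" where
  "subexponential_growth V E \<longleftrightarrow>
     (\<exists>i\<in>V. (\<forall>r. finite (graph_ball E i r)) \<and>
       (\<lambda>r. ln (real (card (graph_ball E i r))) / real r) \<longlonglongrightarrow> 0)"


section \<open>Histories and updating rules\<close>

definition histories :: "'v set \<Rightarrow> ('v \<times> nat \<Rightarrow> real) set" where
  "histories V = (V \<times> UNIV) \<rightarrow> {0..1}"

text \<open>\<open>hist_before E i t A\<close> is the restriction of \<open>A\<close> to \<open>(i) \<times> {0, \<dots>, t - 1}\<close>. The value of
  \<^const>\<open>restrict\<close> outside that set does not depend on \<open>A\<close>, so an updating rule applied to it
  sees nothing but this part of the history.\<close>

definition hist_before :: "'v set set \<Rightarrow> 'v \<Rightarrow> nat \<Rightarrow> ('v \<times> nat \<Rightarrow> real) \<Rightarrow> ('v \<times> nat \<Rightarrow> real)" where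
  "hist_before E i t A = restrict A (closed_nbrs E i \<times> {..<t})"

definition local_histories :: "'v set \<Rightarrow> 'v set set \<Rightarrow> 'v \<Rightarrow> nat \<Rightarrow> ('v \<times> nat \<Rightarrow> real) set" where
  "local_histories V E i t = hist_before E i t ` histories V"

type_synonym 'v rule = "'v \<Rightarrow> nat \<Rightarrow> ('v \<times> nat \<Rightarrow> real) \<Rightarrow> real"

definition updating_rule :: "'v set \<Rightarrow> 'v set set \<Rightarrow> 'v rule \<Rightarrow> bool" where
  "updating_rule V E g \<longleftrightarrow> (\<forall>i\<in>V. \<forall>t>0. g i t \<in> local_histories V E i t \<rightarrow> {0..1})"

definition consistent_histories ::
    "'v set \<Rightarrow> 'v set set \<Rightarrow> 'v rule \<Rightarrow> ('v \<times> nat \<Rightarrow> real) set" where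
  "consistent_histories V E g =
     {A \<in> histories V. \<forall>i\<in>V. \<forall>t>0. A (i, t) = g i t (hist_before E i t A)}"

definition consistent_local_histories ::
    "'v set \<Rightarrow> 'v set set \<Rightarrow> 'v rule \<Rightarrow> 'v \<Rightarrow> nat \<Rightarrow> ('v \<times> nat \<Rightarrow> real) set" where
  "consistent_local_histories V E g i t = hist_before E i t ` consistent_histories V E g"

text \<open>\<open>dynamics V E g S \<beta> A\<close>: \<open>A\<close> is induced by \<open>g\<close> with the set \<open>S\<close> of stubborn agents and with
  \<open>\<beta>\<close>-distorted monitoring. The distorted history \<open>h\<close> may depend on \<open>i\<close> and \<open>t\<close>.\<close>

definition dynamics ::
    "'v set \<Rightarrow> 'v set set \<Rightarrow> 'v rule \<Rightarrow> 'v set \<Rightarrow> real \<Rightarrow> ('v \<times> nat \<Rightarrow> real) \<Rightarrow> bool" where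
  "dynamics V E g S \<beta> A \<longleftrightarrow>
     A \<in> histories V \<and>
     (\<forall>i\<in>S. \<forall>t. A (i, t) = A (i, 0)) \<and>
     (\<forall>i\<in>V - S. \<forall>t>0. \<exists>h\<in>local_histories V E i t.
        (\<forall>s<t. h (i, s) = A (i, s)) \<and>
        (\<forall>j\<in>nbrs E i. \<forall>s<t. \<bar>h (j, s) - A (j, s)\<bar> \<le> \<beta>) \<and>
        A (i, t) = g i t h)"

text \<open>The rule that is in force once the agents in \<open>S\<close> are stubborn; it equals \<open>g\<close> if
  \<open>S = {}\<close>. A stubborn agent ignores \<open>g\<close> and keeps its initial opinion.\<close>

definition stubborn_rule :: "'v set \<Rightarrow> 'v rule \<Rightarrow> 'v rule" where
  "stubborn_rule S g i t h = (if i \<in> S then h (i, 0) else g i t h)"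


section \<open>Conditions (A3) and (A3')\<close>

text \<open>For a history \<open>h\<close> restricted to \<open>(i) \<times> {0, \<dots>, t - 1}\<close>, the terms with \<open>j\<close> outside \<open>(i)\<close>
  vanish because \<open>W i j = 0\<close>.\<close>

definition degroot ::
    "'v set \<Rightarrow> ('v \<Rightarrow> 'v \<Rightarrow> real) \<Rightarrow> 'v \<Rightarrow> nat \<Rightarrow> ('v \<times> nat \<Rightarrow> real) \<Rightarrow> real" where
  "degroot V W i t h =
     1 / enn2real (total_weight V W i) * (\<Sum>\<^sub>\<infinity>j\<in>V. W i j * h (j, t - 1))"

definition A3_inequality ::
    "'v set \<Rightarrow> ('v \<Rightarrow> 'v \<Rightarrow> real) \<Rightarrow> 'v rule \<Rightarrow> real \<Rightarrow> real \<Rightarrow>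
     'v \<Rightarrow> nat \<Rightarrow> ('v \<times> nat \<Rightarrow> real) \<Rightarrow> bool" where
  "A3_inequality V W g \<gamma> \<eta> i t h \<longleftrightarrow>
     (\<forall>v\<in>{degroot V W i t h - \<gamma> .. degroot V W i t h + \<gamma>}.
        \<eta> * \<bar>g i t h - h (i, t - 2)\<bar> \<le> (h (i, t - 2) - v)\<^sup>2 - (g i t h - v)\<^sup>2)"

definition condition_A3 ::
    "'v set \<Rightarrow> 'v set set \<Rightarrow> ('v \<Rightarrow> 'v \<Rightarrow> real) \<Rightarrow> 'v rule \<Rightarrow> real \<Rightarrow> real \<Rightarrow> bool" where
  "condition_A3 V E W g \<gamma> \<eta> \<longleftrightarrow>
     (\<forall>i\<in>V. \<forall>t\<ge>2. \<forall>h\<in>local_histories V E i t. A3_inequality V W g \<gamma> \<eta> i t h)"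

definition condition_A3' ::
    "'v set \<Rightarrow> 'v set set \<Rightarrow> ('v \<Rightarrow> 'v \<Rightarrow> real) \<Rightarrow> 'v rule \<Rightarrow> real \<Rightarrow> real \<Rightarrow> bool" where
  "condition_A3' V E W g \<gamma> \<eta> \<longleftrightarrow>
     (\<forall>i\<in>V. \<forall>t\<ge>2. \<forall>h\<in>consistent_local_histories V E g i t. A3_inequality V W g \<gamma> \<eta> i t h)"

text \<open>When some agents are stubborn, the histories consistent with \<open>g\<close> do not contain the actual
  dynamics, and \<open>condition_A3'\<close> for \<open>g\<close> itself would say nothing about it. With a set \<open>S\<close> of
  stubborn agents the condition is therefore to be read for \<^term>\<open>stubborn_rule S g\<close>: its
  consistent histories are exactly the undistorted dynamics of \<open>g\<close> with stubborn set \<open>S\<close>, and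
  for the agents in \<open>S\<close> the inequality is trivial.\<close>

end

theory Submission
  imports Defs
begin

text \<open>On a finite graph, \<open>\<Sum>i j. W i j (A (i, t + 1) - A (j, t))\<^sup>2\<close> is a Lyapunov function: by the
  symmetry of \<open>W\<close> its decrease is \<open>\<Sum>i. W i ((A (i, t) - v)\<^sup>2 - (A (i, t + 2) - v)\<^sup>2)\<close>, where \<open>v\<close> is
  the DeGroot value at \<open>i\<close>, and (A3) bounds this below by a multiple of \<open>\<bar>A (i, t + 2) - A (i, t)\<bar>\<close>,
  so the opinions of each parity have bounded variation. On an infinite graph, \<open>W i j\<close> is
  replaced by \<open>W i j c i c j\<close> with \<open>c i = q ^ d i\<close>, where \<open>d\<close> is the distance to a root and
  \<open>q = 1 / (1 + \<gamma> - \<beta>)\<close>. Sub-exponential growth makes the Lyapunov function finite, and as \<open>c\<close>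
  changes along an edge by a factor of at most \<open>1 / q\<close>, the reweighted mean differs from the DeGroot
  value by at most \<open>1 / q - 1 = \<gamma> - \<beta>\<close>, which is exactly the room that (A3) leaves once the
  distortion is accounted for.\<close>

lemma convergent_parity_if_bounded_variation:
  fixes x :: "nat \<Rightarrow> real"
  assumes bounded: "\<And>n. (\<Sum>t<n. \<bar>x (t + 2) - x t\<bar>) \<le> C"
  shows "convergent (\<lambda>t. x (2 * t + k))"
proof -
  have "summable (\<lambda>t. \<bar>x (t + 2) - x t\<bar>)"
    by (rule summableI_nonneg_bounded[OF _ bounded]) simp
  then have "summable ((\<lambda>t. \<bar>x (t + 2) - x t\<bar>) \<circ> (\<lambda>t. 2 * t + k))"
    by (rule summable_reindex) (auto simp: inj_def)
  then have "summable (\<lambda>t. \<bar>x (2 * Suc t + k) - x (2 * t + k)\<bar>)"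
    by (simp add: o_def algebra_simps)
  then have "summable (\<lambda>t. x (2 * Suc t + k) - x (2 * t + k))"
    by (rule summable_rabs_cancel)
  then have "convergent (\<lambda>n. \<Sum>t<n. x (2 * Suc t + k) - x (2 * t + k))"
    by (simp add: summable_iff_convergent)
  also have "(\<lambda>n. \<Sum>t<n. x (2 * Suc t + k) - x (2 * t + k)) = (\<lambda>n. x (2 * n + k) - x (2 * 0 + k))"
    by (rule ext, rule sum_lessThan_telescope)
  finally have "convergent (\<lambda>n. x (2 * n + k) - x k + x k)"
    by (intro convergent_add convergent_const) simp
  then show ?thesis
    by simp
qed

lemma sum_sq_diff_eq_mean:
  fixes w a :: "'a \<Rightarrow> real"
  assumes "(\<Sum>j\<in>K. w j * a j) = (\<Sum>j\<in>K. w j) * v"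
  shows "(\<Sum>j\<in>K. w j * ((x - a j)\<^sup>2 - (y - a j)\<^sup>2)) = (\<Sum>j\<in>K. w j) * ((x - v)\<^sup>2 - (y - v)\<^sup>2)"
proof -
  have "(\<Sum>j\<in>K. w j * ((x - a j)\<^sup>2 - (y - a j)\<^sup>2))
      = (\<Sum>j\<in>K. w j * (x\<^sup>2 - y\<^sup>2) - 2 * (x - y) * (w j * a j))"
    by (intro sum.cong refl) (simp add: power2_eq_square algebra_simps)
  also have "\<dots> = (\<Sum>j\<in>K. w j) * (x\<^sup>2 - y\<^sup>2) - 2 * (x - y) * (\<Sum>j\<in>K. w j * a j)"
    by (simp only: sum_subtractf sum_distrib_left sum_distrib_right)
  finally show ?thesis
    unfolding assms by (simp add: power2_eq_square algebra_simps)
qed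

lemma weighted_mean_perturb:
  fixes w c a :: "'a \<Rightarrow> real"
  assumes w: "\<And>j. j \<in> K \<Longrightarrow> 0 \<le> w j" and c: "\<And>j. j \<in> K \<Longrightarrow> \<bar>c j - c0\<bar> \<le> \<delta> * c j"
    and a: "\<And>j. j \<in> K \<Longrightarrow> \<bar>a j - v\<bar> \<le> 1"
    and v: "(\<Sum>j\<in>K. w j * a j) = (\<Sum>j\<in>K. w j) * v"
    and v': "(\<Sum>j\<in>K. w j * c j * a j) = (\<Sum>j\<in>K. w j * c j) * v'"
    and pos: "0 < (\<Sum>j\<in>K. w j * c j)"
  shows "\<bar>v' - v\<bar> \<le> \<delta>"
proof -
  have "(\<Sum>j\<in>K. w j * c j) * (v' - v) = (\<Sum>j\<in>K. w j * c j * (a j - v))"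
    by (simp add: right_diff_distrib sum_subtractf v' sum_distrib_right)
  also have "\<dots> = (\<Sum>j\<in>K. w j * (c j - c0) * (a j - v)) + c0 * ((\<Sum>j\<in>K. w j * a j) - (\<Sum>j\<in>K. w j) * v)"
    unfolding sum_distrib_left sum_distrib_right sum_subtractf[symmetric] sum.distrib[symmetric]
    by (intro sum.cong refl) (simp add: algebra_simps)
  also have "\<dots> = (\<Sum>j\<in>K. w j * (c j - c0) * (a j - v))"
    by (simp add: v)
  finally have eq: "(\<Sum>j\<in>K. w j * c j) * (v' - v) = (\<Sum>j\<in>K. w j * (c j - c0) * (a j - v))" .
  have "\<bar>w j * (c j - c0) * (a j - v)\<bar> \<le> \<delta> * (w j * c j)" if j: "j \<in> K" for j
  proof -
    have "\<bar>(c j - c0) * (a j - v)\<bar> \<le> (\<delta> * c j) * 1"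
      unfolding abs_mult using c[OF j] a[OF j] by (intro mult_mono) auto
    from mult_left_mono[OF this w[OF j]] show ?thesis
      using w[OF j] by (simp add: abs_mult mult_ac)
  qed
  then have "\<bar>(\<Sum>j\<in>K. w j * (c j - c0) * (a j - v))\<bar> \<le> (\<Sum>j\<in>K. \<delta> * (w j * c j))"
    by (intro order_trans[OF sum_abs] sum_mono)
  also have "\<dots> = (\<Sum>j\<in>K. w j * c j) * \<delta>"
    by (simp add: sum_distrib_left mult.commute)
  finally have "(\<Sum>j\<in>K. w j * c j) * \<bar>v' - v\<bar> \<le> (\<Sum>j\<in>K. w j * c j) * \<delta>"
    unfolding eq[symmetric] abs_mult using pos by simp
  then show ?thesis
    using pos by simp
qed

lemma lyapunov_total_variation:
  fixes w :: "'v \<Rightarrow> 'v \<Rightarrow> real" and x :: "'v \<Rightarrow> nat \<Rightarrow> real"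
  assumes N_fin: "\<And>i. i \<in> V \<Longrightarrow> finite (N i)"
    and N_sym: "\<And>i j. i \<in> V \<Longrightarrow> j \<in> N i \<Longrightarrow> j \<in> V \<and> i \<in> N j"
    and w_nonneg: "\<And>i j. i \<in> V \<Longrightarrow> j \<in> N i \<Longrightarrow> 0 \<le> w i j"
    and w_sym: "\<And>i j. i \<in> V \<Longrightarrow> j \<in> N i \<Longrightarrow> w i j = w j i"
    and w_summable: "(\<lambda>(i, j). w i j) summable_on Sigma V N"
    and x: "\<And>i t. i \<in> V \<Longrightarrow> x i t \<in> {0..1}"
    and \<eta>: "0 \<le> \<eta>"
    and decrease: "\<And>i t. i \<in> V \<Longrightarrow> \<eta> * (\<Sum>j\<in>N i. w i j) * \<bar>x i (t + 2) - x i t\<bar>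
      \<le> (\<Sum>j\<in>N i. w i j * ((x i t - x j (t + 1))\<^sup>2 - (x i (t + 2) - x j (t + 1))\<^sup>2))"
    and i: "i \<in> V"
  shows "\<eta> * (\<Sum>j\<in>N i. w i j) * (\<Sum>t<n. \<bar>x i (t + 2) - x i t\<bar>) \<le> (\<Sum>\<^sub>\<infinity>(i, j)\<in>Sigma V N. w i j)"
proof -
  define f where "f s t = (\<lambda>(i, j). w i j * (x i s - x j t)\<^sup>2)" for s t
  define L where "L t = infsum (f (t + 1) t) (Sigma V N)" for t
  have f_le: "f s t p \<le> (case p of (i, j) \<Rightarrow> w i j)" and f_nonneg: "0 \<le> f s t p"
    if p_in: "p \<in> Sigma V N" for s t p
  proof -
    obtain i j where p: "p = (i, j)" "i \<in> V" "j \<in> N i" "j \<in> V"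
      using p_in N_sym by (meson SigmaE)
    have "\<bar>x i s - x j t\<bar> \<le> 1"
      using x[OF p(2), of s] x[OF p(4), of t] by auto
    then have "(x i s - x j t)\<^sup>2 \<le> 1"
      by (simp add: abs_square_le_1)
    then show "f s t p \<le> (case p of (i, j) \<Rightarrow> w i j)" "0 \<le> f s t p"
      using w_nonneg[OF p(2,3)] by (auto simp: f_def p mult_left_le)
  qed
  have f_summable: "f s t summable_on Sigma V N" for s t
    by (rule summable_on_comparison_test[OF w_summable]) (fact f_le f_nonneg)+
  have swap: "infsum (f s t) (Sigma V N) = infsum (f t s) (Sigma V N)" for s t
  proof -
    have "bij_betw prod.swap (Sigma V N) (Sigma V N)"
      by (rule bij_betwI[where g = prod.swap]) (auto dest: N_sym)
    then have "infsum (f t s) (Sigma V N) = infsum (\<lambda>p. f t s (prod.swap p)) (Sigma V N)"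
      by (rule infsum_reindex_bij_betw[symmetric])
    also have "\<dots> = infsum (f s t) (Sigma V N)"
    proof (rule infsum_cong)
      fix p assume "p \<in> Sigma V N"
      then show "f t s (prod.swap p) = f s t p"
        using w_sym[of "fst p" "snd p"] by (cases p) (auto simp: f_def power2_commute)
    qed
    finally show ?thesis ..
  qed
  have step: "\<eta> * (\<Sum>j\<in>N i. w i j) * \<bar>x i (t + 2) - x i t\<bar> \<le> L t - L (t + 1)" for t
  proof -
    define h where "h p = f t (t + 1) p + - f (t + 2) (t + 1) p" for p
    have h_summable: "h summable_on Sigma V N"
      unfolding h_def
      by (intro summable_on_add f_summable) (simp add: summable_on_uminus f_summable)
    have h_i: "\<eta> * (\<Sum>j\<in>N i. w i j) * \<bar>x i (t + 2) - x i t\<bar> \<le> infsum (\<lambda>j. h (i, j)) (N i)"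
      if "i \<in> V" for i
      using decrease[OF that, of t] N_fin[OF that]
      by (simp add: h_def f_def right_diff_distrib)
    have nonneg: "0 \<le> \<eta> * (\<Sum>j\<in>N i. w i j) * \<bar>x i (t + 2) - x i t\<bar>" if "i \<in> V" for i
      using \<eta> w_nonneg[OF that] by (intro mult_nonneg_nonneg sum_nonneg) auto
    have "(\<lambda>i. infsum (\<lambda>j. h (i, j)) (N i)) summable_on V"
      by (rule summable_on_Sigma_banach) (use h_summable in simp)
    then have "sum (\<lambda>i. infsum (\<lambda>j. h (i, j)) (N i)) {i} \<le> (\<Sum>\<^sub>\<infinity>i\<in>V. infsum (\<lambda>j. h (i, j)) (N i))"
      by (rule finite_sum_le_infsum) (use i in \<open>auto intro: order_trans[OF nonneg h_i]\<close>)
    also have "\<dots> = infsum h (Sigma V N)"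
      by (rule infsum_Sigma_banach[OF h_summable])
    also have "\<dots> = infsum (f t (t + 1)) (Sigma V N) - infsum (f (t + 2) (t + 1)) (Sigma V N)"
      unfolding h_def
      by (subst infsum_add) (simp_all add: f_summable summable_on_uminus infsum_uminus)
    also have "\<dots> = L t - L (t + 1)"
      unfolding L_def by (subst swap[of t "t + 1"]) simp
    finally show ?thesis
      using h_i[OF i] by simp
  qed
  have "\<eta> * (\<Sum>j\<in>N i. w i j) * (\<Sum>t<n. \<bar>x i (t + 2) - x i t\<bar>) \<le> (\<Sum>t<n. L t - L (Suc t))"
    unfolding sum_distrib_left[where A = "{..<n}"] by (intro sum_mono) (use step in simp)
  also have "\<dots> = L 0 - L n"
    by (rule sum_lessThan_telescope')
  also have "\<dots> \<le> L 0"
    unfolding L_def using infsum_nonneg[of "Sigma V N" "f (n + 1) n", OF f_nonneg] by simp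
  also have "\<dots> \<le> (\<Sum>\<^sub>\<infinity>(i, j)\<in>Sigma V N. w i j)"
    unfolding L_def by (rule infsum_mono[OF f_summable w_summable f_le])
  finally show ?thesis .
qed

lemma summable_growth_times_power:
  fixes b :: "nat \<Rightarrow> nat"
  assumes lim: "(\<lambda>r. ln (real (b r)) / real r) \<longlonglongrightarrow> 0" and q: "0 < q" "q < 1"
  shows "summable (\<lambda>r. real (b r) * q ^ r)"
proof (rule summable_comparison_test_ev)
  define e where "e = - ln q / 2"
  have e: "0 < e"
    using q by (simp add: e_def)
  show "summable (\<lambda>r. (exp (- e)) ^ r)"
    using e by (intro summable_geometric) simp
  have "\<forall>\<^sub>F r in sequentially. ln (real (b r)) / real r < e"
    by (rule order_tendstoD(2)[OF lim e])
  then show "\<forall>\<^sub>F r in sequentially. norm (real (b r) * q ^ r) \<le> exp (- e) ^ r"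
    using eventually_gt_at_top[of 0]
  proof eventually_elim
    case (elim r)
    show ?case
    proof (cases "b r = 0")
      case False
      have "q = exp (- 2 * e)"
        using q by (simp add: e_def)
      then have "q ^ r = exp (real r * (- 2 * e))"
        by (metis exp_of_nat_mult)
      then have "real (b r) * q ^ r = exp (ln (real (b r)) + real r * (- 2 * e))"
        using False by (simp only: exp_add) simp
      also have "\<dots> \<le> exp (- e * real r)"
        using elim by (simp add: field_simps)
      also have "\<dots> = exp (- e) ^ r"
        by (simp add: exp_of_nat_mult[symmetric] mult.commute)
      finally show ?thesis
        using q by simp
    qed simp
  qed
qed

lemma summable_on_power_of_level:
  fixes d :: "'v \<Rightarrow> nat"
  assumes fin: "\<And>r. finite (B r)" and B: "\<And>i. i \<in> V \<Longrightarrow> i \<in> B (d i)"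
    and sum: "summable (\<lambda>r. real (card (B r)) * q ^ r)" and q: "0 \<le> q"
  shows "(\<lambda>i. q ^ d i) summable_on V"
proof (rule nonneg_bounded_partial_sums_imp_summable_on)
  show "\<forall>\<^sub>F F in finite_subsets_at_top V. (\<Sum>i\<in>F. q ^ d i) \<le> (\<Sum>r. real (card (B r)) * q ^ r)"
  proof (rule eventually_finite_subsets_at_top_weakI)
    fix F assume F: "finite F" "F \<subseteq> V"
    have "(\<Sum>i\<in>F. q ^ d i) = (\<Sum>r\<in>d ` F. \<Sum>i\<in>{i \<in> F. d i = r}. q ^ d i)"
      by (rule sum.image_gen[OF F(1)])
    also have "\<dots> = (\<Sum>r\<in>d ` F. real (card {i \<in> F. d i = r}) * q ^ r)"
      by simp
    also have "\<dots> \<le> (\<Sum>r\<in>d ` F. real (card (B r)) * q ^ r)"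
    proof (intro sum_mono mult_right_mono of_nat_mono card_mono fin)
      show "{i \<in> F. d i = r} \<subseteq> B r" for r
        using F(2) B by blast
    qed (use q in simp)
    also have "\<dots> \<le> (\<Sum>r. real (card (B r)) * q ^ r)"
      using sum F q by (intro sum_le_suminf) auto
    finally show "(\<Sum>i\<in>F. q ^ d i) \<le> (\<Sum>r. real (card (B r)) * q ^ r)" .
  qed
qed (use q in simp)

definition graph_dist :: "'v set set \<Rightarrow> 'v \<Rightarrow> 'v \<Rightarrow> nat" where
  "graph_dist E r i = (LEAST n. (r, i) \<in> adj E ^^ n)"

lemma closed_nbrs_sym: "j \<in> closed_nbrs E i \<longleftrightarrow> i \<in> closed_nbrs E j"
  by (auto simp: closed_nbrs_def nbrs_def insert_commute)

lemma closed_nbrs_subset: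
  assumes "connected_graph V E" "i \<in> V"
  shows "closed_nbrs E i \<subseteq> V"
  using assms by (auto simp: connected_graph_def closed_nbrs_def nbrs_def doubleton_eq_iff)

lemma adj_power_graph_dist:
  assumes "connected_graph V E" "r \<in> V" "i \<in> V"
  shows "(r, i) \<in> adj E ^^ graph_dist E r i"
proof -
  have "\<exists>n. (r, i) \<in> adj E ^^ n"
    using assms by (simp add: connected_graph_def rtrancl_is_UN_relpow)
  then show ?thesis
    unfolding graph_dist_def by (rule LeastI_ex)
qed

lemma graph_dist_closed_nbrs_le:
  assumes "connected_graph V E" "r \<in> V" "i \<in> V" "j \<in> closed_nbrs E i"
  shows "graph_dist E r j \<le> Suc (graph_dist E r i)"
proof (cases "j = i")
  case False
  then have "(i, j) \<in> adj E"
    using assms(4) by (simp add: closed_nbrs_def nbrs_def adj_def)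
  then have "(r, j) \<in> adj E ^^ Suc (graph_dist E r i)"
    using adj_power_graph_dist[OF assms(1-3)] by auto
  then show ?thesis
    unfolding graph_dist_def[of E r j] by (rule Least_le)
qed simp

lemma in_graph_ball_graph_dist:
  assumes "connected_graph V E" "r \<in> V" "i \<in> V" "graph_dist E r i \<le> n"
  shows "i \<in> graph_ball E r n"
  using adj_power_graph_dist[OF assms(1-3)] assms(4) by (auto simp: graph_ball_def)

lemma finite_closed_nbrs:
  assumes "connected_graph V E" "r \<in> V" "\<And>n. finite (graph_ball E r n)" "i \<in> V"
  shows "finite (closed_nbrs E i)"
proof (rule finite_subset)
  show "closed_nbrs E i \<subseteq> graph_ball E r (Suc (graph_dist E r i))"
    using assms closed_nbrs_subset[OF assms(1,4)]
    by (auto intro!: in_graph_ball_graph_dist graph_dist_closed_nbrs_le)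
qed (rule assms(3))

lemma total_weight_eq_sum:
  assumes "weighted_graph V E W" "i \<in> V" "finite (closed_nbrs E i)"
  shows "total_weight V W i = ennreal (\<Sum>j\<in>closed_nbrs E i. W i j)"
proof -
  note wg = assms(1)[unfolded weighted_graph_def]
  have sub: "closed_nbrs E i \<subseteq> V"
    using wg assms(2) by (blast dest: closed_nbrs_subset)
  have "total_weight V W i = (\<Sum>\<^sub>\<infinity>j\<in>closed_nbrs E i. ennreal (W i j))"
    unfolding total_weight_def
  proof (rule infsum_cong_neutral)
    fix j assume "j \<in> V - closed_nbrs E i"
    then have "\<not> W i j > 0"
      using wg assms(2) by (auto simp: closed_nbrs_def nbrs_def)
    then show "ennreal (W i j) = 0"
      by (simp add: ennreal_neg)
  qed (use sub in auto)
  also have "\<dots> = ennreal (\<Sum>j\<in>closed_nbrs E i. W i j)"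
    using assms(2,3) wg sub by (simp add: sum_ennreal subset_iff)
  finally show ?thesis .
qed

lemma degroot_eq_sum:
  assumes "weighted_graph V E W" "i \<in> V" "finite (closed_nbrs E i)"
  shows "degroot V W i t h
    = (\<Sum>j\<in>closed_nbrs E i. W i j * h (j, t - 1)) / (\<Sum>j\<in>closed_nbrs E i. W i j)"
proof -
  note wg = assms(1)[unfolded weighted_graph_def]
  have sub: "closed_nbrs E i \<subseteq> V"
    using wg assms(2) by (blast dest: closed_nbrs_subset)
  have "(\<Sum>\<^sub>\<infinity>j\<in>V. W i j * h (j, t - 1)) = (\<Sum>\<^sub>\<infinity>j\<in>closed_nbrs E i. W i j * h (j, t - 1))"
  proof (rule infsum_cong_neutral)
    fix j assume j: "j \<in> V - closed_nbrs E i"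
    then have "\<not> W i j > 0"
      using wg assms(2) by (auto simp: closed_nbrs_def nbrs_def)
    moreover have "0 \<le> W i j"
      using wg assms(2) j by simp
    ultimately show "W i j * h (j, t - 1) = 0"
      by simp
  qed (use sub in auto)
  moreover have "0 \<le> (\<Sum>j\<in>closed_nbrs E i. W i j)"
    using wg assms(2) sub by (intro sum_nonneg) auto
  ultimately show ?thesis
    by (simp add: degroot_def total_weight_eq_sum[OF assms] assms(3))
qed

lemma degroot_perturb:
  assumes "weighted_graph V E W" "i \<in> V" "finite (closed_nbrs E i)" "0 \<le> \<beta>"
    and h: "\<And>j. j \<in> closed_nbrs E i \<Longrightarrow> \<bar>h (j, t - 1) - A (j, t - 1)\<bar> \<le> \<beta>"
  shows "\<bar>degroot V W i t h - degroot V W i t A\<bar> \<le> \<beta>"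
proof -
  have W: "0 \<le> W i j" if "j \<in> closed_nbrs E i" for j
    using assms(1,2) closed_nbrs_subset[of V E i] that by (auto simp: weighted_graph_def)
  have "\<bar>\<Sum>j\<in>closed_nbrs E i. W i j * (h (j, t - 1) - A (j, t - 1))\<bar> \<le> (\<Sum>j\<in>closed_nbrs E i. W i j * \<beta>)"
    using W h by (intro order_trans[OF sum_abs] sum_mono) (simp add: abs_mult mult_left_mono)
  then have "\<bar>\<Sum>j\<in>closed_nbrs E i. W i j * (h (j, t - 1) - A (j, t - 1))\<bar>
      \<le> \<beta> * (\<Sum>j\<in>closed_nbrs E i. W i j)"
    by (simp add: sum_distrib_left mult.commute)
  moreover have "0 \<le> (\<Sum>j\<in>closed_nbrs E i. W i j)"
    using W by (rule sum_nonneg)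
  moreover have "degroot V W i t h - degroot V W i t A
      = (\<Sum>j\<in>closed_nbrs E i. W i j * (h (j, t - 1) - A (j, t - 1))) / (\<Sum>j\<in>closed_nbrs E i. W i j)"
    by (simp add: degroot_eq_sum[OF assms(1-3)] diff_divide_distrib sum_subtractf right_diff_distrib)
  ultimately show ?thesis
    using assms(4) by (cases "(\<Sum>j\<in>closed_nbrs E i. W i j) = 0") (simp_all add: divide_le_eq)
qed

lemma A3_inequality_shift:
  assumes "A3_inequality V W g \<gamma> \<eta> i t h" "h (i, t - 2) = A (i, t - 2)" "A (i, t) = g i t h"
    and "\<bar>degroot V W i t h - degroot V W i t A\<bar> \<le> \<beta>" "\<bar>v - degroot V W i t A\<bar> \<le> \<gamma> - \<beta>"
  shows "\<eta> * \<bar>A (i, t) - A (i, t - 2)\<bar> \<le> (A (i, t - 2) - v)\<^sup>2 - (A (i, t) - v)\<^sup>2"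
proof -
  have "v \<in> {degroot V W i t h - \<gamma> .. degroot V W i t h + \<gamma>}"
    using assms(4,5) by auto
  then show ?thesis
    using assms(1-3) by (simp add: A3_inequality_def)
qed

lemma dynamics_descent:
  assumes wg: "weighted_graph V E W" and dyn: "dynamics V E g S \<beta> A" and "0 \<le> \<beta>"
    and A3: "condition_A3 V E W g \<gamma> \<eta> \<or> (\<beta> = 0 \<and> condition_A3' V E W (stubborn_rule S g) \<gamma> \<eta>)"
    and i: "i \<in> V" and fin: "finite (closed_nbrs E i)" and t: "2 \<le> t"
    and v: "\<bar>v - degroot V W i t A\<bar> \<le> \<gamma> - \<beta>"
  shows "\<eta> * \<bar>A (i, t) - A (i, t - 2)\<bar> \<le> (A (i, t - 2) - v)\<^sup>2 - (A (i, t) - v)\<^sup>2"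
proof -
  have A: "A \<in> histories V"
    and stubborn: "\<And>i s. i \<in> S \<Longrightarrow> A (i, s) = A (i, 0)"
    and active: "\<And>i s. i \<in> V - S \<Longrightarrow> 0 < s \<Longrightarrow> \<exists>h\<in>local_histories V E i s.
        (\<forall>u<s. h (i, u) = A (i, u)) \<and>
        (\<forall>j\<in>nbrs E i. \<forall>u<s. \<bar>h (j, u) - A (j, u)\<bar> \<le> \<beta>) \<and> A (i, s) = g i s h"
    using dyn unfolding dynamics_def by blast+
  show ?thesis
  proof (cases "i \<in> S")
    case True
    from stubborn[OF this, of t] stubborn[OF this, of "t - 2"] show ?thesis
      by simp
  next
    case False
    obtain h where h: "h \<in> local_histories V E i t" "\<And>s. s < t \<Longrightarrow> h (i, s) = A (i, s)"
        "\<And>j s. j \<in> nbrs E i \<Longrightarrow> s < t \<Longrightarrow> \<bar>h (j, s) - A (j, s)\<bar> \<le> \<beta>" "A (i, t) = g i t h"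
      using active[of i t] False i t by auto
    have near: "\<bar>degroot V W i t h - degroot V W i t A\<bar> \<le> \<beta>"
      using h(2)[of "t - 1"] h(3)[of _ "t - 1"] t \<open>0 \<le> \<beta>\<close>
      by (intro degroot_perturb[OF wg i fin]) (auto simp: closed_nbrs_def)
    from A3 show ?thesis
    proof
      assume "condition_A3 V E W g \<gamma> \<eta>"
      then have "A3_inequality V W g \<gamma> \<eta> i t h"
        using i t h(1) by (simp add: condition_A3_def)
      then show ?thesis
        using h(2)[of "t - 2"] t h(4) near v by (intro A3_inequality_shift) auto
    next
      assume *: "\<beta> = 0 \<and> condition_A3' V E W (stubborn_rule S g) \<gamma> \<eta>"
      have undistorted: "hist_before E j s A = h"
        if "h \<in> local_histories V E j s" "\<And>u. u < s \<Longrightarrow> h (j, u) = A (j, u)"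
          "\<And>k u. k \<in> nbrs E j \<Longrightarrow> u < s \<Longrightarrow> \<bar>h (k, u) - A (k, u)\<bar> \<le> \<beta>" for h j s
        using that * by (auto simp: fun_eq_iff hist_before_def local_histories_def restrict_def closed_nbrs_def)
      have "A (j, s) = stubborn_rule S g j s (hist_before E j s A)" if js: "j \<in> V" "0 < s" for j s
      proof (cases "j \<in> S")
        case True
        then show ?thesis
          using stubborn[OF True, of s] js by (simp add: stubborn_rule_def hist_before_def closed_nbrs_def)
      next
        case False
        obtain h where h: "h \<in> local_histories V E j s" "\<And>u. u < s \<Longrightarrow> h (j, u) = A (j, u)"
            "\<And>k u. k \<in> nbrs E j \<Longrightarrow> u < s \<Longrightarrow> \<bar>h (k, u) - A (k, u)\<bar> \<le> \<beta>" "A (j, s) = g j s h"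
          using active[of j s] False js by auto
        then show ?thesis
          using undistorted[OF h(1-3)] False by (simp add: stubborn_rule_def)
      qed
      then have "A \<in> consistent_histories V E (stubborn_rule S g)"
        using A by (simp add: consistent_histories_def)
      then have "A3_inequality V W (stubborn_rule S g) \<gamma> \<eta> i t h"
        using * i t undistorted[OF h(1-3)]
        by (auto simp: condition_A3'_def consistent_local_histories_def)
      then show ?thesis
        using h(2)[of "t - 2"] t h(4) False near v
        by (intro A3_inequality_shift[where g = "stubborn_rule S g"]) (auto simp: stubborn_rule_def)
    qed
  qed
qed

theorem theorem5p1:
  fixes V :: "'v set" and E :: "'v set set" and W :: "'v \<Rightarrow> 'v \<Rightarrow> real"
    and g :: "'v rule" and S :: "'v set" and A :: "'v \<times> nat \<Rightarrow> real"
    and \<beta> \<gamma> \<eta> :: real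
  assumes "weighted_graph V E W"
    and "updating_rule V E g"
    and "S \<subseteq> V"
    and "\<beta> \<ge> 0"
    and "dynamics V E g S \<beta> A"
    and "subexponential_growth V E"
    and "(SUP i\<in>V. total_weight V W i) < \<infinity>"
    and "\<gamma> > \<beta>" and "\<eta> > 0"
    and "condition_A3 V E W g \<gamma> \<eta> \<or> (\<beta> = 0 \<and> condition_A3' V E W (stubborn_rule S g) \<gamma> \<eta>)"
  shows "\<forall>i\<in>V. \<forall>\<iota>\<in>{0, 1}. convergent (\<lambda>t. A (i, 2 * t + \<iota>))"
proof -
  note wg = assms(1)[unfolded weighted_graph_def]
  then have con: "connected_graph V E"
    by simp
  obtain r where r: "r \<in> V" and fin_ball: "\<And>n. finite (graph_ball E r n)"
    and growth: "(\<lambda>n. ln (real (card (graph_ball E r n))) / real n) \<longlonglongrightarrow> 0"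
    using assms(6) by (auto simp: subexponential_growth_def)
  define N where "N = closed_nbrs E"
  define M where "M = enn2real (SUP i\<in>V. total_weight V W i)"
  define \<delta> where "\<delta> = \<gamma> - \<beta>"
  define q where "q = 1 / (1 + \<delta>)"
  define d where "d = graph_dist E r"
  define c where "c i = q ^ d i" for i
  define w where "w i j = c i * (W i j * c j)" for i j

  have \<delta>: "0 < \<delta>"
    using assms(8) by (simp add: \<delta>_def)
  then have q: "0 < q" "q < 1" and q_inv: "(1 + \<delta>) * q = 1"
    by (simp_all add: q_def)
  have c: "0 < c i" "c i \<le> 1" for i
    using q by (simp_all add: c_def power_le_one)
  have fin: "finite (N i)" if "i \<in> V" for i
    unfolding N_def by (rule finite_closed_nbrs[OF con r fin_ball that])
  have N: "j \<in> V" "i \<in> N j" if "i \<in> V" "j \<in> N i" for i j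
    using closed_nbrs_subset[OF con that(1)] that closed_nbrs_sym[of j E i] unfolding N_def by blast+
  have W: "0 \<le> W i j" "W i j = W j i" if "i \<in> V" "j \<in> N i" for i j
    using wg that(1) N(1)[OF that] by blast+
  have sum_W: "(\<Sum>j\<in>N i. W i j) \<le> M" if "i \<in> V" for i
  proof -
    have "ennreal (\<Sum>j\<in>N i. W i j) \<le> (SUP i\<in>V. total_weight V W i)"
      using that total_weight_eq_sum[OF assms(1) that] fin[OF that]
      by (auto simp: N_def intro: SUP_upper2)
    then show ?thesis
      using assms(7) W(1)[OF that] unfolding M_def
      by (metis enn2real_ennreal enn2real_mono infinity_ennreal_def sum_nonneg)
  qed
  have c_close: "\<bar>c j - c i\<bar> \<le> \<delta> * c j" if "i \<in> V" "j \<in> N i" for i j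
  proof -
    have "d j \<le> Suc (d i)" "d i \<le> Suc (d j)"
      using graph_dist_closed_nbrs_le[OF con r, of i j] graph_dist_closed_nbrs_le[OF con r, of j i]
        that N[OF that] by (auto simp: N_def d_def)
    then consider "d i = d j" | "d i = Suc (d j)" | "d j = Suc (d i)"
      by linarith
    then show ?thesis
    proof cases
      case 1
      then show ?thesis
        using c(1)[of j] \<delta> by (simp add: c_def)
    next
      case 2
      have "1 - q \<le> \<delta>"
        using q \<delta> q_inv by (simp add: algebra_simps) (smt (verit) mult_left_le)
      then have "(1 - q) * c j \<le> \<delta> * c j"
        using c(1)[of j] by (intro mult_right_mono) auto
      moreover have "c j - c i = (1 - q) * c j"
        by (simp add: c_def 2 algebra_simps)
      moreover have "0 \<le> (1 - q) * c j"
        using q c(1)[of j] by simp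
      ultimately show ?thesis
        by simp
    next
      case 3
      have "c i = (1 + \<delta>) * q * c i"
        by (simp only: q_inv mult_1)
      also have "\<dots> = c j + \<delta> * c j"
        by (simp add: c_def 3 algebra_simps)
      finally have "c i - c j = \<delta> * c j"
        by simp
      moreover have "0 \<le> \<delta> * c j"
        using \<delta> c(1)[of j] by simp
      ultimately show ?thesis
        by linarith
    qed
  qed
  have opinion: "A (i, t) \<in> {0..1}" if "i \<in> V" for i t
    using assms(5) that by (auto simp: dynamics_def histories_def)
  have degroot: "degroot V W i (t + 2) A = (\<Sum>j\<in>N i. W i j * A (j, t + 1)) / (\<Sum>j\<in>N i. W i j)"
    if "i \<in> V" for i t
    using degroot_eq_sum[OF assms(1) that fin[OF that, unfolded N_def], of "t + 2" A]
    by (simp add: N_def)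
  have descent: "\<eta> * \<bar>A (i, t + 2) - A (i, t)\<bar> \<le> (A (i, t) - v)\<^sup>2 - (A (i, t + 2) - v)\<^sup>2"
    if "i \<in> V" "\<bar>v - degroot V W i (t + 2) A\<bar> \<le> \<delta>" for i t v
    using dynamics_descent[OF assms(1,5,4,10) that(1) fin[OF that(1), unfolded N_def], of "t + 2" v] that
    by (simp add: \<delta>_def)

  have "(\<lambda>i. q ^ d i) summable_on V"
  proof (rule summable_on_power_of_level)
    show "i \<in> graph_ball E r (d i)" if "i \<in> V" for i
      using in_graph_ball_graph_dist[OF con r that] by (simp add: d_def)
  qed (use fin_ball summable_growth_times_power[OF growth q(1,2)] q in auto)
  then have Mc: "(\<lambda>i. M * c i) summable_on V"
    unfolding c_def by (rule summable_on_cmult_right)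
  have w_nonneg: "0 \<le> w i j" if "i \<in> V" "j \<in> N i" for i j
    using W(1)[OF that] c(1)[of i] c(1)[of j] by (simp add: w_def)
  have sum_w_le: "(\<Sum>j\<in>N i. w i j) \<le> M * c i" if "i \<in> V" for i
  proof -
    have "(\<Sum>j\<in>N i. w i j) \<le> (\<Sum>j\<in>N i. c i * W i j)"
      unfolding w_def using W(1)[OF that] c
      by (intro sum_mono mult_left_mono mult_left_le) (auto simp: less_imp_le)
    also have "\<dots> = c i * (\<Sum>j\<in>N i. W i j)"
      by (simp add: sum_distrib_left)
    also have "\<dots> \<le> M * c i"
      using sum_W[OF that] c(1)[of i] by (simp add: mult.commute)
    finally show ?thesis .
  qed
  have w_summable: "(\<lambda>(i, j). w i j) summable_on Sigma V N"
  proof (rule summable_on_SigmaI)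
    show "((\<lambda>j. case (i, j) of (i, j) \<Rightarrow> w i j) has_sum (\<Sum>j\<in>N i. w i j)) (N i)" if "i \<in> V" for i
      using fin[OF that] by simp
    show "(\<lambda>i. \<Sum>j\<in>N i. w i j) summable_on V"
      by (rule summable_on_comparison_test[OF Mc]) (auto intro: sum_w_le sum_nonneg w_nonneg)
  qed (use w_nonneg in simp)
  have decrease: "\<eta> * (\<Sum>j\<in>N i. w i j) * \<bar>A (i, t + 2) - A (i, t)\<bar>
      \<le> (\<Sum>j\<in>N i. w i j * ((A (i, t) - A (j, t + 1))\<^sup>2 - (A (i, t + 2) - A (j, t + 1))\<^sup>2))"
    if i: "i \<in> V" for i t
  proof (cases "(\<Sum>j\<in>N i. W i j) = 0")
    case True
    then have "W i j = 0" if "j \<in> N i" for j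
      using sum_nonneg_eq_0_iff[OF fin[OF i]] W(1)[OF i] that by blast
    then show ?thesis
      by (simp add: w_def)
  next
    case False
    define v where "v = (\<Sum>j\<in>N i. W i j * A (j, t + 1)) / (\<Sum>j\<in>N i. W i j)"
    define v' where "v' = (\<Sum>j\<in>N i. W i j * c j * A (j, t + 1)) / (\<Sum>j\<in>N i. W i j * c j)"
    have pos: "0 < (\<Sum>j\<in>N i. W i j)"
      using False W(1)[OF i] by (simp add: less_le sum_nonneg)
    then obtain k where k: "k \<in> N i" "W i k \<noteq> 0"
      using sum.not_neutral_contains_not_neutral[of "W i" "N i"] by auto
    have posc: "0 < (\<Sum>j\<in>N i. W i j * c j)"
      using k W(1)[OF i] c by (intro sum_pos2[OF fin[OF i] k(1)]) (auto simp: less_le)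
    have "v \<le> 1"
      unfolding v_def using pos W(1)[OF i] opinion N[OF i]
      by (auto simp: divide_le_eq intro!: sum_mono mult_left_le)
    moreover have "0 \<le> v"
      unfolding v_def using W(1)[OF i] opinion N[OF i]
      by (auto intro!: divide_nonneg_nonneg sum_nonneg)
    ultimately have a: "\<bar>A (j, t + 1) - v\<bar> \<le> 1" if "j \<in> N i" for j
      using opinion[OF N(1)[OF i that], of "t + 1"] by (auto simp: abs_le_iff)
    have "\<bar>v' - v\<bar> \<le> \<delta>"
      by (rule weighted_mean_perturb[where K = "N i" and w = "W i" and c = c and ?c0.0 = "c i"
            and a = "\<lambda>j. A (j, t + 1)"])
        (use W(1)[OF i] c_close[OF i] a pos posc in \<open>simp_all add: v_def v'_def\<close>)
    then have "\<eta> * \<bar>A (i, t + 2) - A (i, t)\<bar> \<le> (A (i, t) - v')\<^sup>2 - (A (i, t + 2) - v')\<^sup>2"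
      unfolding v_def degroot[OF i, symmetric] by (rule descent[OF i])
    moreover have "0 \<le> (\<Sum>j\<in>N i. w i j)"
      using w_nonneg[OF i] by (rule sum_nonneg)
    ultimately have "(\<Sum>j\<in>N i. w i j) * (\<eta> * \<bar>A (i, t + 2) - A (i, t)\<bar>)
        \<le> (\<Sum>j\<in>N i. w i j) * ((A (i, t) - v')\<^sup>2 - (A (i, t + 2) - v')\<^sup>2)"
      by (rule mult_left_mono)
    also have "\<dots> = (\<Sum>j\<in>N i. w i j * ((A (i, t) - A (j, t + 1))\<^sup>2 - (A (i, t + 2) - A (j, t + 1))\<^sup>2))"
    proof (rule sum_sq_diff_eq_mean[symmetric])
      have "(\<Sum>j\<in>N i. w i j * A (j, t + 1)) = c i * (\<Sum>j\<in>N i. W i j * c j * A (j, t + 1))"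
        by (simp add: w_def sum_distrib_left mult_ac)
      also have "\<dots> = c i * ((\<Sum>j\<in>N i. W i j * c j) * v')"
        using posc by (simp add: v'_def)
      also have "\<dots> = (\<Sum>j\<in>N i. w i j) * v'"
        by (simp add: w_def sum_distrib_left)
      finally show "(\<Sum>j\<in>N i. w i j * A (j, t + 1)) = (\<Sum>j\<in>N i. w i j) * v'" .
    qed
    finally show ?thesis
      by (simp add: mult_ac)
  qed

  show ?thesis
  proof (intro ballI)
    fix i :: 'v and \<iota> :: nat
    assume i: "i \<in> V"
    have "\<exists>C. \<forall>n. (\<Sum>t<n. \<bar>A (i, t + 2) - A (i, t)\<bar>) \<le> C"
    proof (cases "(\<Sum>j\<in>N i. w i j) = 0")
      case True
      text \<open>All weights at \<open>i\<close> vanish, so the DeGroot value is the junk value \<open>0 / 0 = 0\<close>; the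
        descent inequality around \<open>0\<close> then telescopes at \<open>i\<close> alone.\<close>
      have "W i j = 0" if "j \<in> N i" for j
      proof -
        have "w i j = 0"
          using True that sum_nonneg_eq_0_iff[OF fin[OF i]] w_nonneg[OF i] by blast
        then show ?thesis
          using c(1)[of i] c(1)[of j] by (simp add: w_def)
      qed
      then have "\<eta> * \<bar>A (i, t + 2) - A (i, t)\<bar> \<le> (A (i, t))\<^sup>2 - (A (i, t + 2))\<^sup>2" for t
        using descent[OF i, of 0 t] \<delta> unfolding degroot[OF i] by simp
      then have "\<eta> * (\<Sum>t<n. \<bar>A (i, t + 2) - A (i, t)\<bar>) \<le> (\<Sum>t<n. (A (i, t))\<^sup>2 - (A (i, t + 2))\<^sup>2)" for n
        unfolding sum_distrib_left by (intro sum_mono)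
      moreover have "(\<Sum>t<n. (A (i, t))\<^sup>2 - (A (i, t + 2))\<^sup>2)
          = (A (i, 0))\<^sup>2 + (A (i, 1))\<^sup>2 - (A (i, n))\<^sup>2 - (A (i, n + 1))\<^sup>2" for n
        by (induction n) simp_all
      ultimately have "\<eta> * (\<Sum>t<n. \<bar>A (i, t + 2) - A (i, t)\<bar>) \<le> (A (i, 0))\<^sup>2 + (A (i, 1))\<^sup>2" for n
        by (smt (verit) zero_le_power2)
      then have "(\<Sum>t<n. \<bar>A (i, t + 2) - A (i, t)\<bar>) \<le> ((A (i, 0))\<^sup>2 + (A (i, 1))\<^sup>2) / \<eta>" for n
        using assms(9) by (simp add: le_divide_eq mult.commute)
      then show ?thesis
        by blast
    next
      case False
      then have "0 < (\<Sum>j\<in>N i. w i j)"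
        using w_nonneg[OF i] by (simp add: less_le sum_nonneg)
      then have pos: "0 < \<eta> * (\<Sum>j\<in>N i. w i j)"
        using assms(9) by simp
      have "\<eta> * (\<Sum>j\<in>N i. w i j) * (\<Sum>t<n. \<bar>A (i, t + 2) - A (i, t)\<bar>)
          \<le> (\<Sum>\<^sub>\<infinity>(i, j)\<in>Sigma V N. w i j)" for n
      proof (rule lyapunov_total_variation[where x = "\<lambda>i t. A (i, t)"])
        show "w i j = w j i" if "i \<in> V" "j \<in> N i" for i j
          using W(2)[OF that] by (simp add: w_def)
        show "j \<in> V \<and> i \<in> N j" if "i \<in> V" "j \<in> N i" for i j
          using N[OF that] ..
        show "0 \<le> \<eta>"
          using assms(9) by simp
      qed (fact fin w_nonneg w_summable opinion decrease i)+
      then have "(\<Sum>t<n. \<bar>A (i, t + 2) - A (i, t)\<bar>)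
          \<le> (\<Sum>\<^sub>\<infinity>(i, j)\<in>Sigma V N. w i j) / (\<eta> * (\<Sum>j\<in>N i. w i j))" for n
        using pos by (simp add: pos_le_divide_eq mult.commute)
      then show ?thesis
        by blast
    qed
    then obtain C where "\<And>n. (\<Sum>t<n. \<bar>A (i, t + 2) - A (i, t)\<bar>) \<le> C"
      by blast
    then show "convergent (\<lambda>t. A (i, 2 * t + \<iota>))"
      by (rule convergent_parity_if_bounded_variation)
  qed
qed

end
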